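(* Let $a,b>0$. As $t\to\infty$ the following hold: (i) If $\mu(t)=a\,(\log t)^{-b}$ for all large $t$, then $\mathbb{P}(D>t)\approx_{\log}\mathrm{e}^{-bt\log\log t/\ell}$. (ii) If $\mu(t)=a\,t^{-b}$ for all large $t$, then $\mathbb{P}(D>t)\approx_{\log}\mathrm{e}^{-bt\log t/\ell}$. (iii) If $\mu(t)=a\,\mathrm{e}^{-bt}$ for all large $t$, then $\mathbb{P}(D>t)\approx_{\log}\mathrm{e}^{-bt^2/(2\ell)}$.
   Context: Let $\ell>0$ be fixed. $\mathcal N$ is an inhomogeneous Poisson point process on $(0,\infty)$ with rate function $\mu(t)$, i.e. with intensity measure $\mu(t)\,\mathrm{d}t$; write $M(a,b)=\int_a^b\mu(t)\,\mathrm{d}t$. It is assumed that $M(0,t)<\infty$ for every finite $t$ and that $\mu(t)>0$ for Lebesgue-almost all $t\ge 0$. Let $0<T_1<T_2<\cdots$ be the epochs (points) of $\mathcal N$, with $T_0=0$ by convention; if $\mathcal N$ has only finitely many points, say $n$ of them, then $T_{n+1}=\infty$. Define $D=\min\{T_n:\ n\ge 0,\ T_{n+1}-T_n\ge \ell\}$, with $D=\infty$ if there is no such $n$. The relation $f(t)\approx_{\log} g(t)$ means $\log f(t)/\log g(t)\to 1$ as $t\to\infty$. *)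

theory Defs
  imports "HOL-Probability.Probability"
begin

definition num_points :: "real set \<Rightarrow> real set \<Rightarrow> ennreal" where
  "num_points X B = emeasure (count_space UNIV) (X \<inter> B)"

text \<open>
  A Poisson point process on \<open>(0,\<infinity>)\<close>, given as a random set of points. Multiplicities are not
  needed: the intensities used below have no atoms, so that the process is simple.
  Local finiteness is required on \<open>[0,\<infinity>)\<close>, so the points do not accumulate at \<open>0\<close>. The point
  counts on sets of infinite intensity are infinite almost surely, the usual convention for the
  Poisson law with infinite mean.
\<close>

locale poisson_point_process = prob_space P
  for P :: "'w measure" +
  fixes \<Lambda> :: "real measure" and N :: "'w \<Rightarrow> real set"
  assumes sets_intensity: "sets \<Lambda> = sets (restrict_space borel {0<..})"
    and points_pos: "\<And>\<omega>. \<omega> \<in> space P \<Longrightarrow> N \<omega> \<subseteq> {0<..}"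
    and locally_finite: "\<And>\<omega> t. \<omega> \<in> space P \<Longrightarrow> finite (N \<omega> \<inter> {0<..t})"
    and num_points_measurable:
      "\<And>B. B \<in> sets \<Lambda> \<Longrightarrow> random_variable borel (\<lambda>\<omega>. num_points (N \<omega>) B)"
    and poisson_law:
      "\<And>B k. B \<in> sets \<Lambda> \<Longrightarrow> emeasure \<Lambda> B < \<infinity> \<Longrightarrow>
        prob {\<omega> \<in> space P. num_points (N \<omega>) B = of_nat k} =
          measure \<Lambda> B ^ k / fact k * exp (- measure \<Lambda> B)"
    and poisson_law_infinite:
      "\<And>B. B \<in> sets \<Lambda> \<Longrightarrow> emeasure \<Lambda> B = \<infinity> \<Longrightarrow> AE \<omega> in P. num_points (N \<omega>) B = \<infinity>"
    and independent_counts: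
      "\<And>(B :: nat \<Rightarrow> real set) n. (\<And>i. i < n \<Longrightarrow> B i \<in> sets \<Lambda>) \<Longrightarrow> disjoint_family_on B {..<n} \<Longrightarrow>
        indep_vars (\<lambda>_. borel) (\<lambda>i \<omega>. num_points (N \<omega>) (B i)) {..<n}"

definition intensity :: "(real \<Rightarrow> real) \<Rightarrow> real measure" where
  "intensity \<mu> = density (restrict_space lborel {0<..}) (\<lambda>t. ennreal (\<mu> t))"

text \<open>
  The \<open>n\<close>-th epoch: since \<open>Inf {} = \<infinity>\<close>, a configuration with exactly \<open>n\<close> points has all epochs
  after the \<open>n\<close>-th equal to \<open>\<infinity>\<close>.
\<close>

primrec epoch :: "real set \<Rightarrow> nat \<Rightarrow> ereal" where
  "epoch X 0 = 0"
| "epoch X (Suc n) = Inf {ereal x | x. x \<in> X \<and> epoch X n < ereal x}"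

text \<open>
  The epochs are nondecreasing in \<open>n\<close>, so the infimum is a minimum unless the set is empty, in
  which case it is \<open>\<infinity>\<close>. The condition \<open>epoch X n < \<infinity>\<close> excludes the meaningless difference
  \<open>\<infinity> - \<infinity>\<close>.
\<close>

definition first_gap :: "real \<Rightarrow> real set \<Rightarrow> ereal" where
  "first_gap l X =
    Inf {epoch X n | n. epoch X n < \<infinity> \<and> epoch X (Suc n) - epoch X n \<ge> ereal l}"

definition log_equiv :: "(real \<Rightarrow> real) \<Rightarrow> (real \<Rightarrow> real) \<Rightarrow> bool"  (infix "\<approx>\<^bsub>log\<^esub>" 50) where
  "f \<approx>\<^bsub>log\<^esub> g \<longleftrightarrow> ((\<lambda>t. ln (f t) / ln (g t)) \<longlongrightarrow> 1) at_top"

end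

theory Submission imports Defs "HOL-Real_Asymp.Real_Asymp" begin

text \<open>
  Write \<open>\<mu> = exp (- h)\<close> near infinity. The event \<open>D > t\<close> says that no window \<open>(s, s + l)\<close> with
  \<open>0 \<le> s \<le> t\<close> is free of points (\<open>first_gap_gt_iff\<close>). This gives two product bounds by the
  independence of the process on disjoint sets.

  \<^item> If \<open>D > t\<close>, then each of the disjoint windows \<open>(k l, (k + 1) l]\<close> with \<open>k l \<le> t\<close> contains a point.

  \<^item> Conversely, let \<open>c + \<delta> < l\<close> and \<open>\<delta> \<le> c\<close>. If each of the disjoint windows \<open>(k c, k c + \<delta>]\<close>, up to a
    little beyond \<open>t\<close>, contains a point, then \<open>D > t\<close>, because points in neighbouring windows are
    at most \<open>c + \<delta>\<close> apart.

  Since \<open>h\<close> tends to infinity, a far window at \<open>x\<close> has small mass, of order \<open>exp (- h x)\<close>; it contains a point with a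
  probability of the same order, so its contribution to \<open>- ln P(D > t)\<close> is asymptotically \<open>h x\<close>,
  whatever the fixed length of the window. Both bounds therefore amount to the sum of \<open>h\<close>
  over a lattice in \<open>[0, t]\<close>, of mesh \<open>l\<close> in the first case and \<open>c\<close> in the second. Such a sum behaves like
  \<open>\<Phi> t\<close> divided by the mesh, where \<open>\<Phi>\<close> is any function whose increments over the mesh are asymptotically those
  of an antiderivative of \<open>h\<close> (\<open>sum_lattice_asymp\<close>). Since \<open>c < l\<close> can be
  taken arbitrarily close to \<open>l\<close>, it follows that \<open>- ln P(D > t)\<close> is asymptotic to \<open>\<Phi> t / l\<close>
  (\<open>first_gap_tail_log_equiv\<close>). The three cases are \<open>h t = b ln (ln t) - ln a\<close>, \<open>b ln t - ln a\<close> and \<open>b t - ln a\<close>, with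
  \<open>\<Phi> t = b t ln (ln t)\<close>, \<open>b t ln t\<close> and \<open>b t\<^sup>2 / 2\<close>.
\<close>

section \<open>Epochs and empty windows\<close>

lemma num_points_eq_0_iff: "num_points X B = 0 \<longleftrightarrow> X \<inter> B = {}"
  by (auto simp: num_points_def emeasure_count_space)

lemma first_point_above:
  fixes X :: "real set" and s :: real
  assumes loc: "\<And>t. finite (X \<inter> {0<..t})" and s: "0 \<le> s" and ne: "X \<inter> {s<..} \<noteq> {}"
  obtains x where "x \<in> X" "s < x" "\<And>y. y \<in> X \<Longrightarrow> s < y \<Longrightarrow> x \<le> y"
proof -
  obtain p where p: "p \<in> X" "s < p" using ne by auto
  let ?A = "X \<inter> {s<..p}"
  have fin: "finite ?A" by (rule finite_subset[OF _ loc[of p]]) (use s in auto)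
  have "?A \<noteq> {}" using p by auto
  with fin have "Min ?A \<in> ?A" by (rule Min_in)
  moreover have "Min ?A \<le> y" if "y \<in> X" "s < y" for y
    using that p Min_le[OF fin, of y] Min_le[OF fin, of p] by (cases "y \<le> p") auto
  ultimately show thesis using that[of "Min ?A"] by auto
qed

lemma epoch_Suc_ge: "epoch X n \<le> epoch X (Suc n)"
  by (auto intro!: Inf_greatest)

lemma epoch_nonneg: "0 \<le> epoch X n"
proof (induction n)
  case (Suc n)
  then show ?case using epoch_Suc_ge by (rule order_trans)
qed simp

text \<open>
  By local finiteness the infimum that defines the next epoch is attained as soon as some point
  lies above the current epoch.
\<close>

lemma epoch_Suc_attained:
  assumes loc: "\<And>t. finite (X \<inter> {0<..t})" and s: "epoch X n = ereal s"
    and fin: "epoch X (Suc n) \<noteq> \<infinity>"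
  obtains x where "x \<in> X" "s < x" "epoch X (Suc n) = ereal x"
proof -
  have "X \<inter> {s<..} \<noteq> {}"
  proof
    assume "X \<inter> {s<..} = {}"
    then have empty: "{ereal x | x. x \<in> X \<and> epoch X n < ereal x} = {}" using s by auto
    have "epoch X (Suc n) = \<infinity>" unfolding epoch.simps empty by (simp add: top_ereal_def)
    then show False using fin by simp
  qed
  moreover have "0 \<le> s" using epoch_nonneg[of X n] s by simp
  ultimately obtain x where
    x: "x \<in> X" "s < x" "\<And>y. y \<in> X \<Longrightarrow> s < y \<Longrightarrow> x \<le> y"
    using first_point_above[OF loc] by metis
  have "epoch X (Suc n) = ereal x"
    unfolding epoch.simps by (rule antisym) (use x s in \<open>auto intro!: Inf_lower Inf_greatest\<close>)
  with x that show thesis by blast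
qed

lemma epoch_0_or_point:
  assumes loc: "\<And>t. finite (X \<inter> {0<..t})" and r: "epoch X n = ereal r"
  shows "r = 0 \<or> r \<in> X"
proof (cases n)
  case (Suc m)
  have "epoch X m < \<infinity>" using epoch_Suc_ge[of X m] r Suc by auto
  then obtain s where s: "epoch X m = ereal s"
    using epoch_nonneg[of X m] by (cases "epoch X m") auto
  obtain x where "x \<in> X" "epoch X (Suc m) = ereal x"
    by (rule epoch_Suc_attained[OF loc s]) (use r Suc in auto)
  then show ?thesis using r Suc by simp
qed (use r in simp)

text \<open>
  Otherwise all epochs are at most \<open>s\<close>; they are then strictly increasing and make up infinitely many
  points in \<open>(0,s]\<close>.
\<close>

lemma last_epoch_before:
  assumes loc: "\<And>t. finite (X \<inter> {0<..t})" and s: "0 \<le> s"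
  obtains n where "epoch X n \<le> ereal s" "ereal s < epoch X (Suc n)"
proof (rule ccontr)
  assume neg: "\<not> thesis"
  have le: "epoch X n \<le> ereal s" for n
  proof (induction n)
    case (Suc n)
    then show ?case using neg that[of n] by (metis not_le)
  qed (use s in auto)
  define e where "e n = real_of_ereal (epoch X n)" for n
  have e: "epoch X n = ereal (e n)" for n
    unfolding e_def using le[of n] epoch_nonneg[of X n] by (cases "epoch X n") auto
  have step: "e (Suc n) \<in> X" "e n < e (Suc n)" for n
    using epoch_Suc_attained[OF loc e, of n] e[of "Suc n"] by (metis PInfty_neq_ereal(1) ereal.inject)+
  then have mono: "strict_mono e" by (simp add: strict_mono_Suc_iff)
  have bounds: "0 \<le> e n" "e n \<le> s" for n using epoch_nonneg[of X n] le[of n] e by auto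
  have "0 < e (Suc n)" for n using le_less_trans[OF bounds(1)[of n] step(2)[of n]] .
  then have "range (\<lambda>n. e (Suc n)) \<subseteq> X \<inter> {0<..s}"
    using step bounds by auto
  then have "finite (range (\<lambda>n. e (Suc n)))" using loc finite_subset by blast
  moreover have "inj (\<lambda>n. e (Suc n))" using mono by (auto simp: inj_on_def strict_mono_eq)
  ultimately show False using finite_imageD by blast
qed

text \<open>
  If a window \<open>(s, s + l)\<close> is free of points, then the last epoch up to \<open>s\<close> is followed by a gap
  of length at least \<open>l\<close>. Conversely, an epoch \<open>r \<le> t\<close> with such a gap after it makes the window
  at \<open>s = r\<close> free of points.
\<close>

lemma first_gap_gt_iff:
  assumes loc: "\<And>t. finite (X \<inter> {0<..t})" and l: "l > 0" and t: "t \<ge> 0"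
  shows "first_gap l X > ereal t \<longleftrightarrow> (\<forall>s\<in>{0..t}. X \<inter> {s<..<s + l} \<noteq> {})"
proof
  assume gap: "first_gap l X > ereal t"
  show "\<forall>s\<in>{0..t}. X \<inter> {s<..<s + l} \<noteq> {}"
  proof (intro ballI notI)
    fix s assume s: "s \<in> {0..t}" and empty: "X \<inter> {s<..<s + l} = {}"
    obtain n where n: "epoch X n \<le> ereal s" "ereal s < epoch X (Suc n)"
      using last_epoch_before[OF loc, of s] s by auto
    obtain r where r: "epoch X n = ereal r" "r \<le> s"
      using n epoch_nonneg[of X n] by (cases "epoch X n") auto
    have "ereal (s + l) \<le> ereal x" if x: "x \<in> X" "epoch X n < ereal x" for x
    proof -
      have "epoch X (Suc n) \<le> ereal x" using x by (auto intro: Inf_lower)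
      then have "s < x" using n by (metis ereal_less_eq(3) leD le_less_linear order_trans)
      then show ?thesis using empty x by (auto simp: not_less)
    qed
    then have "ereal (s + l) \<le> epoch X (Suc n)" by (auto intro!: Inf_greatest)
    then have "epoch X (Suc n) - epoch X n \<ge> ereal l"
      using r by (cases "epoch X (Suc n)") auto
    then have "first_gap l X \<le> epoch X n"
      unfolding first_gap_def using r by (auto intro!: Inf_lower exI[of _ n])
    also have "\<dots> \<le> ereal t" using r s by simp
    finally show False using gap by simp
  qed
next
  assume hit: "\<forall>s\<in>{0..t}. X \<inter> {s<..<s + l} \<noteq> {}"
  \<comment> \<open>An infimum of values above \<open>t\<close> might equal \<open>t\<close>; the first point after \<open>t\<close> bounds it away from \<open>t\<close>.\<close>
  have "X \<inter> {t<..<t + l} \<noteq> {}" using hit t by simp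
  then have "X \<inter> {t<..} \<noteq> {}" by auto
  from first_point_above[OF loc t this] obtain x where
    x: "x \<in> X" "t < x" "\<And>y. y \<in> X \<Longrightarrow> t < y \<Longrightarrow> x \<le> y" by metis
  have "ereal x \<le> epoch X n"
    if n: "epoch X n < \<infinity>" "epoch X (Suc n) - epoch X n \<ge> ereal l" for n
  proof -
    obtain r where r: "epoch X n = ereal r" "0 \<le> r"
      using n epoch_nonneg[of X n] by (cases "epoch X n") auto
    have "t < r"
    proof (rule ccontr)
      assume "\<not> t < r"
      then obtain p where p: "p \<in> X" "r < p" "p < r + l" using hit r by force
      then have "epoch X (Suc n) \<le> ereal p" using r by (auto intro: Inf_lower)
      then show False using n r p by (cases "epoch X (Suc n)") auto
    qed
    then have "r \<in> X" using epoch_0_or_point[OF loc r(1)] t by auto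
    with \<open>t < r\<close> x r show ?thesis by simp
  qed
  then have "ereal x \<le> first_gap l X"
    unfolding first_gap_def by (auto intro!: Inf_greatest)
  with x(2) show "first_gap l X > ereal t" by (metis ereal_less_eq(3) leD le_less_linear order_trans)
qed

text \<open>
  This expresses the event \<open>D > t\<close> by countably many counts, which makes it measurable; this
  matters for the lower bound, as \<open>measure\<close> is \<open>0\<close> by default on non-measurable sets. If for each
  \<open>m\<close> some shrunken window is free of points, a limit of its positions along a subsequence is, by compactness of
  \<open>[0,t]\<close>, the position of an open window that is free of points.
\<close>

lemma windows_hit_iff_rational:
  fixes X :: "real set"
  assumes t: "t > 0"
  shows "(\<forall>s\<in>{0..t}. X \<inter> {s<..<s + l} \<noteq> {}) \<longleftrightarrow>
    (\<exists>m. \<forall>q\<in>\<rat> \<inter> {0..t}. X \<inter> {q + 1 / Suc m..q + l - 1 / Suc m} \<noteq> {})"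
proof (intro iffI ballI notI)
  assume hit: "\<forall>s\<in>{0..t}. X \<inter> {s<..<s + l} \<noteq> {}"
  show "\<exists>m. \<forall>q\<in>\<rat> \<inter> {0..t}. X \<inter> {q + 1 / Suc m..q + l - 1 / Suc m} \<noteq> {}"
  proof (rule ccontr)
    assume "\<not> ?thesis"
    then have "\<forall>m. \<exists>q. q \<in> {0..t} \<and> X \<inter> {q + 1 / Suc m..q + l - 1 / Suc m} = {}"
      by blast
    then obtain q where q: "\<And>m. q m \<in> {0..t}"
      "\<And>m. X \<inter> {q m + 1 / Suc m..q m + l - 1 / Suc m} = {}" by metis
    obtain s r where s: "s \<in> {0..t}" "strict_mono r" "(q \<circ> r) \<longlonglongrightarrow> s"
      using compact_Icc[of 0 t, unfolded compact_def] q(1) by metis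
    obtain x where x: "x \<in> X" "s < x" "x < s + l" using hit s(1) by force
    have inv: "(\<lambda>m. 1 / real (Suc (r m))) \<longlonglongrightarrow> 0"
      using LIMSEQ_subseq_LIMSEQ[OF lim_inverse_n' [THEN LIMSEQ_Suc] s(2)] by (simp add: o_def)
    have "(\<lambda>m. q (r m) + 1 / Suc (r m)) \<longlonglongrightarrow> s + 0"
      using s(3) by (intro tendsto_add inv) (simp add: o_def)
    then have 1: "\<forall>\<^sub>F m in sequentially. q (r m) + 1 / Suc (r m) < x"
      using x by (intro order_tendstoD) auto
    have "(\<lambda>m. q (r m) + l - 1 / Suc (r m)) \<longlonglongrightarrow> s + l - 0"
      using s(3) by (intro tendsto_add tendsto_diff inv tendsto_const) (simp add: o_def)
    then have 2: "\<forall>\<^sub>F m in sequentially. x < q (r m) + l - 1 / Suc (r m)"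
      using x by (intro order_tendstoD) auto
    obtain m where "q (r m) + 1 / Suc (r m) < x" "x < q (r m) + l - 1 / Suc (r m)"
      using eventually_happens[OF eventually_conj[OF 1 2]] by auto
    then show False using q(2)[of "r m"] x(1) by (auto simp: disjoint_iff dest!: spec[of _ x])
  qed
next
  fix s assume "\<exists>m. \<forall>q\<in>\<rat> \<inter> {0..t}. X \<inter> {q + 1 / Suc m..q + l - 1 / Suc m} \<noteq> {}"
    and s: "s \<in> {0..t}" and empty: "X \<inter> {s<..<s + l} = {}"
  then obtain m where m: "\<And>q. q \<in> \<rat> \<Longrightarrow> q \<in> {0..t} \<Longrightarrow> X \<inter> {q + 1 / Suc m..q + l - 1 / Suc m} \<noteq> {}"
    by blast
  define d where "d = 1 / real (Suc m)"
  have d: "d > 0" by (simp add: d_def)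
  have "max 0 (s - d) < min t (s + d)" using s t d by auto
  then obtain q where q: "q \<in> \<rat>" "max 0 (s - d) < q" "q < min t (s + d)"
    using Rats_dense_in_real by blast
  then obtain x where x: "x \<in> X" "q + d \<le> x" "x \<le> q + l - d" using m[of q] unfolding d_def by force
  then have "x \<in> X \<inter> {s<..<s + l}" using q by auto
  with empty show False by blast
qed

section \<open>Product bounds from disjoint windows\<close>

lemma disjoint_family_lattice_windows:
  assumes "\<delta> \<le> c"
  shows "disjoint_family_on (\<lambda>k::nat. {real k * c<..real k * c + \<delta>}) A"
proof -
  have "{real i * c<..real i * c + \<delta>} \<inter> {real j * c<..real j * c + \<delta>} = {}" if "i < j" for i j :: nat
  proof -
    show ?thesis
    proof (cases "\<delta> \<le> 0")
      case False
      have "real i + 1 \<le> real j" using that by simp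
      then have "(real i + 1) * c \<le> real j * c" using assms False by (intro mult_right_mono) auto
      then show ?thesis using assms by (auto simp: algebra_simps)
    qed auto
  qed
  then show ?thesis unfolding disjoint_family_on_def by (metis Int_commute linorder_neqE_nat)
qed

context poisson_point_process
begin

lemma Ioc_sets_intensity: "0 \<le> x \<Longrightarrow> {x<..y} \<in> sets \<Lambda>"
  unfolding sets_intensity by (subst sets_restrict_space_iff) auto

lemma Icc_sets_intensity: "0 < x \<Longrightarrow> {x..y} \<in> sets \<Lambda>"
  unfolding sets_intensity by (subst sets_restrict_space_iff) auto

lemma emeasure_Ioc_finite:
  assumes "\<And>s. emeasure \<Lambda> {0<..s} < \<infinity>" "0 \<le> x"
  shows "emeasure \<Lambda> {x<..y} < \<infinity>"
proof -
  have "{x<..y} \<subseteq> {0<..y}" using assms(2) by auto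
  then have "emeasure \<Lambda> {x<..y} \<le> emeasure \<Lambda> {0<..y}"
    by (rule emeasure_mono) (rule Ioc_sets_intensity, simp)
  then show ?thesis using assms(1)[of y] by (rule le_less_trans)
qed

lemma hit_sets [measurable]:
  assumes "B \<in> sets \<Lambda>"
  shows "{\<omega> \<in> space P. N \<omega> \<inter> B \<noteq> {}} \<in> events"
proof -
  note num_points_measurable[OF assms, measurable]
  have "{\<omega> \<in> space P. num_points (N \<omega>) B \<noteq> 0} \<in> events" by measurable
  then show ?thesis by (simp add: num_points_eq_0_iff)
qed

lemma sets_first_gap_gt:
  assumes "l > 0" "t > 0"
  shows "{\<omega> \<in> space P. first_gap l (N \<omega>) > ereal t} \<in> events"
proof -
  have *: "first_gap l (N \<omega>) > ereal t \<longleftrightarrow>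
     (\<exists>m. \<forall>q\<in>\<rat> \<inter> {0..t}. N \<omega> \<inter> {q + 1 / Suc m..q + l - 1 / Suc m} \<noteq> {})"
    if "\<omega> \<in> space P" for \<omega>
    using first_gap_gt_iff[OF locally_finite[OF that] assms(1), of t] windows_hit_iff_rational[of t]
      assms by simp
  have "{\<omega> \<in> space P. N \<omega> \<inter> {q + 1 / Suc m..q + l - 1 / Suc m} \<noteq> {}} \<in> events"
    if "q \<in> \<rat> \<inter> {0..t}" for q m
    by (intro hit_sets Icc_sets_intensity) (use that in \<open>auto intro: add_nonneg_pos\<close>)
  moreover have "countable (\<rat> \<inter> {0..t})" using countable_rat by blast
  ultimately have "{\<omega> \<in> space P. \<exists>m. \<forall>q\<in>\<rat> \<inter> {0..t}.
      N \<omega> \<inter> {q + 1 / Suc m..q + l - 1 / Suc m} \<noteq> {}} \<in> events"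
    by (intro sets.sets_Collect_countable_Ex sets.sets_Collect_countable_All')
  also have "{\<omega> \<in> space P. \<exists>m. \<forall>q\<in>\<rat> \<inter> {0..t}.
      N \<omega> \<inter> {q + 1 / Suc m..q + l - 1 / Suc m} \<noteq> {}} =
      {\<omega> \<in> space P. first_gap l (N \<omega>) > ereal t}"
    using * by (intro Collect_cong) auto
  finally show ?thesis .
qed

lemma prob_hit:
  assumes "B \<in> sets \<Lambda>" "emeasure \<Lambda> B < \<infinity>"
  shows "prob {\<omega> \<in> space P. N \<omega> \<inter> B \<noteq> {}} = 1 - exp (- measure \<Lambda> B)"
proof -
  have "{\<omega> \<in> space P. N \<omega> \<inter> B \<noteq> {}} = space P - {\<omega> \<in> space P. num_points (N \<omega>) B = of_nat 0}"
    by (auto simp: num_points_eq_0_iff)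
  moreover have "{\<omega> \<in> space P. num_points (N \<omega>) B = of_nat 0} \<in> events"
    using num_points_measurable[OF assms(1), measurable] by measurable
  ultimately show ?thesis using poisson_law[OF assms, of 0] by (simp add: prob_compl)
qed

text \<open>
  A window is empty with probability \<open>exp (- M)\<close>, where \<open>M\<close> is its mass, and counts in disjoint windows are independent.
\<close>

lemma prob_all_hit:
  fixes B :: "nat \<Rightarrow> real set"
  assumes B: "\<And>i. i < n \<Longrightarrow> B i \<in> sets \<Lambda>" "\<And>i. i < n \<Longrightarrow> emeasure \<Lambda> (B i) < \<infinity>"
    and disj: "disjoint_family_on B {..<n}"
  shows "prob {\<omega> \<in> space P. \<forall>i<n. N \<omega> \<inter> B i \<noteq> {}} = (\<Prod>i<n. 1 - exp (- measure \<Lambda> (B i)))"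
proof (cases "n = 0")
  case False
  let ?X = "\<lambda>i \<omega>. num_points (N \<omega>) (B i)"
  have hit: "?X i -` {0<..} \<inter> space P = {\<omega> \<in> space P. N \<omega> \<inter> B i \<noteq> {}}" for i
    by (auto simp: zero_less_iff_neq_zero num_points_eq_0_iff)
  have "prob (\<Inter>i\<in>{..<n}. ?X i -` {0<..} \<inter> space P) = (\<Prod>i<n. prob (?X i -` {0<..} \<inter> space P))"
    by (rule indep_varsD_finite[OF independent_counts]) (use B disj False in auto)
  moreover have "(\<Inter>i\<in>{..<n}. ?X i -` {0<..} \<inter> space P) = {\<omega> \<in> space P. \<forall>i<n. N \<omega> \<inter> B i \<noteq> {}}"
    unfolding hit using False by auto
  ultimately show ?thesis unfolding hit using B by (simp add: prob_hit)
qed (simp add: prob_space)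

lemma all_hit_sets:
  fixes B :: "nat \<Rightarrow> real set"
  assumes "\<And>i. i < n \<Longrightarrow> B i \<in> sets \<Lambda>"
  shows "{\<omega> \<in> space P. \<forall>i<n. N \<omega> \<inter> B i \<noteq> {}} \<in> events"
proof -
  have "{\<omega> \<in> space P. \<forall>i\<in>{..<n}. N \<omega> \<inter> B i \<noteq> {}} \<in> events"
  proof (rule sets.sets_Collect_countable_All')
    show "{\<omega> \<in> space P. N \<omega> \<inter> B i \<noteq> {}} \<in> events" if "i \<in> {..<n}" for i
      using assms[of i] that by (intro hit_sets) simp
  qed simp
  then show ?thesis by (simp only: lessThan_iff Ball_def)
qed

text \<open>
  The windows \<open>(k l, (k + 1) l]\<close> tile the half-line, and none of those that start by time \<open>t\<close> may be
  empty when \<open>D > t\<close>.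
\<close>

lemma prob_first_gap_gt_le:
  assumes "l > 0" "t > 0" and fin: "\<And>s. emeasure \<Lambda> {0<..s} < \<infinity>"
    and n: "\<And>k. k < n \<Longrightarrow> real k * l \<le> t"
  shows "prob {\<omega> \<in> space P. first_gap l (N \<omega>) > ereal t} \<le>
    (\<Prod>k<n. 1 - exp (- measure \<Lambda> {real k * l<..real k * l + l}))"
proof -
  note fin' = emeasure_Ioc_finite[OF fin]
  have hits: "N \<omega> \<inter> {real k * l<..real k * l + l} \<noteq> {}"
    if "\<omega> \<in> space P" "first_gap l (N \<omega>) > ereal t" "k < n" for \<omega> k
  proof -
    have "real k * l \<in> {0..t}" using n[OF that(3)] assms by simp
    then have "N \<omega> \<inter> {real k * l<..<real k * l + l} \<noteq> {}"
      using first_gap_gt_iff[OF locally_finite[OF that(1)] assms(1), of t] that assms by simp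
    then show ?thesis by force
  qed
  have "prob {\<omega> \<in> space P. first_gap l (N \<omega>) > ereal t} \<le>
    prob {\<omega> \<in> space P. \<forall>k<n. N \<omega> \<inter> {real k * l<..real k * l + l} \<noteq> {}}"
    using assms hits by (intro finite_measure_mono all_hit_sets Ioc_sets_intensity) auto
  also have "\<dots> = (\<Prod>k<n. 1 - exp (- measure \<Lambda> {real k * l<..real k * l + l}))"
    using assms by (intro prob_all_hit Ioc_sets_intensity fin' disjoint_family_lattice_windows) auto
  finally show ?thesis .
qed

text \<open>
  For \<open>s \<le> t\<close> the first lattice point \<open>(j + 1) c\<close> after \<open>s\<close> is at most \<open>s + c\<close>, so a point in the
  window of length \<open>\<delta>\<close> that starts there lies in \<open>(s, s + c + \<delta>]\<close>, hence in \<open>(s, s + l)\<close>.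
  The last of the \<open>n\<close> windows has to start after \<open>t\<close>, so that the window that serves \<open>s = t\<close> is among them.
\<close>

lemma prob_first_gap_gt_ge:
  assumes "l > 0" "t > 0" and fin: "\<And>s. emeasure \<Lambda> {0<..s} < \<infinity>"
    and c: "0 < c" "0 < \<delta>" "\<delta> \<le> c" "c + \<delta> < l"
    and n: "t < real (n - 1) * c"
  shows "(\<Prod>k<n. 1 - exp (- measure \<Lambda> {real k * c<..real k * c + \<delta>})) \<le>
    prob {\<omega> \<in> space P. first_gap l (N \<omega>) > ereal t}"
proof -
  note fin' = emeasure_Ioc_finite[OF fin]
  have gap: "first_gap l (N \<omega>) > ereal t"
    if \<omega>: "\<omega> \<in> space P" and hits: "\<forall>k<n. N \<omega> \<inter> {real k * c<..real k * c + \<delta>} \<noteq> {}" for \<omega>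
  proof -
    have "N \<omega> \<inter> {s<..<s + l} \<noteq> {}" if s: "s \<in> {0..t}" for s
    proof -
      define j where "j = nat \<lfloor>s / c\<rfloor>"
      have "0 \<le> s / c" using s c(1) by simp
      then have "real j = of_int \<lfloor>s / c\<rfloor>" unfolding j_def by simp
      then have "real j \<le> s / c" "s / c < real j + 1"
        using of_int_floor_le[of "s / c"] floor_correct[of "s / c"] by simp_all
      then have j: "real j * c \<le> s" "s < real (Suc j) * c"
        using c(1) by (simp_all add: pos_le_divide_eq pos_divide_less_eq add.commute)
      have "real j * c < real (n - 1) * c" using j(1) n s by simp
      then have "real j < real (n - 1)" using c by simp
      then have "Suc j < n" by linarith
      with hits have "N \<omega> \<inter> {real (Suc j) * c<..real (Suc j) * c + \<delta>} \<noteq> {}" by blast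
      then obtain x where x: "x \<in> N \<omega>" "real (Suc j) * c < x" "x \<le> real (Suc j) * c + \<delta>"
        by (auto simp del: of_nat_Suc)
      have "real (Suc j) * c = real j * c + c" by (simp add: algebra_simps)
      with x j c have "s < x" "x < s + l" by linarith+
      with x have "x \<in> N \<omega> \<inter> {s<..<s + l}" by simp
      then show ?thesis by blast
    qed
    then show ?thesis using first_gap_gt_iff[OF locally_finite[OF \<omega>] assms(1), of t] assms by simp
  qed
  have "(\<Prod>k<n. 1 - exp (- measure \<Lambda> {real k * c<..real k * c + \<delta>})) =
     prob {\<omega> \<in> space P. \<forall>k<n. N \<omega> \<inter> {real k * c<..real k * c + \<delta>} \<noteq> {}}"
    using assms by (intro prob_all_hit[symmetric] Ioc_sets_intensity fin' disjoint_family_lattice_windows) auto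
  also have "\<dots> \<le> prob {\<omega> \<in> space P. first_gap l (N \<omega>) > ereal t}"
    using assms gap by (intro finite_measure_mono sets_first_gap_gt) auto
  finally show ?thesis .
qed

end

section \<open>The mass of a window\<close>

lemma emeasure_intensity_Ioc:
  assumes "\<mu> \<in> borel_measurable (restrict_space borel {0<..})" "0 \<le> x"
  shows "emeasure (intensity \<mu>) {x<..y} =
    (\<integral>\<^sup>+t. ennreal (\<mu> t) * indicator {0<..} t * indicator {x<..y} t \<partial>lborel)"
proof -
  have [measurable]: "\<mu> \<in> borel_measurable (restrict_space lborel {0<..})"
    using assms(1) by (subst measurable_cong_sets[OF sets_restrict_space_cong[OF sets_lborel] refl])
  have "{x<..y} \<in> sets (restrict_space lborel {0<..})"
    using assms(2) by (subst sets_restrict_space_iff) auto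
  then show ?thesis
    unfolding intensity_def
    by (subst emeasure_density)
      (auto simp: nn_integral_restrict_space ac_simps)
qed

lemma window_mass_bounds:
  assumes meas: "\<mu> \<in> borel_measurable (restrict_space borel {0<..})"
    and bounds: "\<And>t. t \<in> {x<..x + \<delta>} \<Longrightarrow> m \<le> \<mu> t \<and> \<mu> t \<le> m'"
    and "0 \<le> x" "0 < \<delta>" "0 \<le> m"
  shows "\<delta> * m \<le> measure (intensity \<mu>) {x<..x + \<delta>}" "measure (intensity \<mu>) {x<..x + \<delta>} \<le> \<delta> * m'"
proof -
  let ?E = "emeasure (intensity \<mu>) {x<..x + \<delta>}"
  have const: "(\<integral>\<^sup>+t. ennreal k * indicator {x<..x + \<delta>} t \<partial>lborel) = ennreal (\<delta> * k)" if "k \<ge> 0" for k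
    using assms that by (simp add: nn_integral_cmult_indicator ennreal_mult' mult.commute)
  have "m \<le> m'" using bounds[of "x + \<delta>"] \<open>0 < \<delta>\<close> by simp
  have "ennreal (\<delta> * m) \<le> ?E"
    unfolding const[OF \<open>0 \<le> m\<close>, symmetric] emeasure_intensity_Ioc[OF meas \<open>0 \<le> x\<close>]
    by (intro nn_integral_mono) (use bounds assms in \<open>auto simp: indicator_def intro!: ennreal_leI\<close>)
  moreover have "?E \<le> ennreal (\<delta> * m')"
    unfolding const[OF order_trans[OF \<open>0 \<le> m\<close> \<open>m \<le> m'\<close>], symmetric] emeasure_intensity_Ioc[OF meas \<open>0 \<le> x\<close>]
    by (intro nn_integral_mono) (use bounds assms in \<open>auto simp: indicator_def intro!: ennreal_leI\<close>)
  moreover from this have "?E = ennreal (measure (intensity \<mu>) {x<..x + \<delta>})"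
    by (intro emeasure_eq_ennreal_measure) (auto simp: top_unique)
  ultimately show "\<delta> * m \<le> measure (intensity \<mu>) {x<..x + \<delta>}" "measure (intensity \<mu>) {x<..x + \<delta>} \<le> \<delta> * m'"
    using assms \<open>m \<le> m'\<close> by (simp_all add: ennreal_le_iff)
qed

text \<open>
  This makes every factor of the product bounds positive, so that logarithms can be taken term by
  term, also for the finitely many windows that lie outside the range where \<open>\<mu>\<close> is known.
\<close>

lemma window_mass_pos:
  assumes meas: "\<mu> \<in> borel_measurable (restrict_space borel {0<..})"
    and fin: "\<And>t. emeasure (intensity \<mu>) {0<..t} < \<infinity>"
    and pos: "AE t in lborel. t \<ge> 0 \<longrightarrow> \<mu> t > 0"
    and x: "0 \<le> x" "x < y"
  shows "0 < measure (intensity \<mu>) {x<..y}"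
proof -
  let ?g = "\<lambda>t. ennreal (\<mu> t) * indicator {0<..} t"
  have [measurable]: "?g \<in> borel_measurable borel"
    using meas by (subst borel_measurable_restrict_space_iff_ennreal[symmetric]) auto
  have "emeasure (intensity \<mu>) {x<..y} \<noteq> 0"
  proof
    assume "emeasure (intensity \<mu>) {x<..y} = 0"
    then have "AE t in lborel. ?g t * indicator {x<..y} t = 0"
      unfolding emeasure_intensity_Ioc[OF meas x(1)] by (subst (asm) nn_integral_0_iff_AE) auto
    with pos have "AE t in lborel. t \<notin> {x<..y}"
      by eventually_elim (use x in \<open>auto simp: indicator_def split: if_splits\<close>)
    then have "emeasure lborel {x<..y} = 0"
      by (subst (asm) AE_iff_measurable[of "{x<..y}"]) auto
    then show False using x by simp
  qed
  moreover have "emeasure (intensity \<mu>) {x<..y} \<le> emeasure (intensity \<mu>) {0<..y}"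
    unfolding emeasure_intensity_Ioc[OF meas x(1)] emeasure_intensity_Ioc[OF meas order_refl]
    using x by (intro nn_integral_mono) (auto simp: indicator_def)
  ultimately show ?thesis
    using fin[of y] by (simp add: measure_def enn2real_positive_iff less_top zero_less_iff_neq_zero)
qed

text \<open>
  The mass of the window lies between \<open>\<delta> exp (- h (k c + \<delta>))\<close> and \<open>\<delta> exp (- h (k c))\<close>. Its
  negative logarithm is therefore asymptotic to \<open>h (k c)\<close>: the constant \<open>ln \<delta>\<close> is negligible as \<open>h\<close>
  is unbounded, and the shift by \<open>\<delta>\<close> is harmless by hypothesis. Finally \<open>ln (1 - exp (- x))\<close> is
  asymptotic to \<open>ln x\<close> for small \<open>x\<close>.
\<close>

lemma neg_ln_hit_prob_asymp:
  fixes h :: "real \<Rightarrow> real"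
  assumes meas: "\<mu> \<in> borel_measurable (restrict_space borel {0<..})"
    and \<mu>: "\<forall>\<^sub>F t in at_top. \<mu> t = exp (- h t)"
    and mono: "mono_on {T..} h" and h: "filterlim h at_top at_top"
    and shift: "\<And>d. d > 0 \<Longrightarrow> (\<lambda>t. h (t + d)) \<sim>[at_top] h"
    and c: "0 < c" "0 < \<delta>"
  shows "(\<lambda>k::nat. - ln (1 - exp (- measure (intensity \<mu>) {real k * c<..real k * c + \<delta>}))) \<sim>[at_top]
    (\<lambda>k. h (real k * c))"
proof -
  define M where "M k = measure (intensity \<mu>) {real k * c<..real k * c + \<delta>}" for k :: nat
  have kc: "filterlim (\<lambda>k::nat. real k * c) at_top at_top"
    using c by real_asymp
  obtain T' where T': "\<And>t. t \<ge> T' \<Longrightarrow> \<mu> t = exp (- h t)"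
    using \<mu> by (auto simp: eventually_at_top_linorder)
  have bounds: "\<forall>\<^sub>F k in at_top. \<delta> * exp (- h (real k * c + \<delta>)) \<le> M k \<and> M k \<le> \<delta> * exp (- h (real k * c))"
    using filterlim_at_top[THEN iffD1, OF kc, rule_format, of "max 0 (max T T')"]
  proof eventually_elim
    case (elim k)
    have "exp (- h (real k * c + \<delta>)) \<le> \<mu> t \<and> \<mu> t \<le> exp (- h (real k * c))"
      if "t \<in> {real k * c<..real k * c + \<delta>}" for t
      using that elim T'[of t] mono_onD[OF mono, of t "real k * c + \<delta>"]
        mono_onD[OF mono, of "real k * c" t] by simp
    then show ?case unfolding M_def using elim c by (intro conjI window_mass_bounds meas) auto
  qed
  have ln_bounds: "\<forall>\<^sub>F k in at_top. - ln (M k) \<in> {h (real k * c) - ln \<delta>..h (real k * c + \<delta>) - ln \<delta>}"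
    using bounds
  proof eventually_elim
    case (elim k)
    then have "M k > 0" using c by (meson exp_gt_zero less_le_trans mult_pos_pos)
    then have "ln (\<delta> * exp (- h (real k * c + \<delta>))) \<le> ln (M k)" "ln (M k) \<le> ln (\<delta> * exp (- h (real k * c)))"
      using elim c by (auto intro!: ln_mono)
    then show ?case using c by (simp add: ln_mult)
  qed
  have const: "(\<lambda>t. f t - ln \<delta>) \<sim>[at_top] h" if "f \<sim>[at_top] h" for f
  proof -
    have "(\<lambda>_. - ln \<delta>) \<in> o[at_top](h)"
      using h by (intro smalloI_tendsto tendsto_divide_0[OF tendsto_const]
          filterlim_at_top_imp_at_infinity filterlim_at_top_dense[THEN iffD1, rule_format, THEN eventually_mono])
        auto
    from asymp_equiv_add_right[OF this, of f] that show ?thesis by simp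
  qed
  have ln_M: "(\<lambda>k. - ln (M k)) \<sim>[at_top] (\<lambda>k. h (real k * c))"
  proof (rule asymp_equiv_sandwich_real[OF _ _ ln_bounds])
    show "(\<lambda>k. h (real k * c) - ln \<delta>) \<sim>[at_top] (\<lambda>k. h (real k * c))"
      by (rule asymp_equiv_compose'[OF const[OF asymp_equiv_refl] kc])
    show "(\<lambda>k. h (real k * c + \<delta>) - ln \<delta>) \<sim>[at_top] (\<lambda>k. h (real k * c))"
      by (rule asymp_equiv_compose'[OF const[OF shift[OF c(2)]] kc])
  qed
  have "((\<lambda>t. \<delta> * exp (- h t)) \<longlongrightarrow> \<delta> * 0) at_top"
    by (intro tendsto_intros filterlim_compose[OF exp_at_bot] filterlim_compose[OF filterlim_uminus_at_bot_at_top h])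
  then have "(\<lambda>k::nat. \<delta> * exp (- h (real k * c))) \<longlonglongrightarrow> 0"
    using filterlim_compose kc by fastforce
  then have "M \<longlonglongrightarrow> 0"
    by (rule tendsto_sandwich[rotated 2, OF tendsto_const])
      (use bounds in \<open>auto simp: M_def elim: eventually_mono\<close>)
  moreover have "\<forall>\<^sub>F k in at_top. M k \<in> {0<..} \<and> M k \<noteq> 0"
    using bounds
  proof eventually_elim
    case (elim k)
    have "0 < \<delta> * exp (- h (real k * c + \<delta>))" using c by simp
    with elim have "0 < M k" by linarith
    then show ?case by simp
  qed
  ultimately have M0: "filterlim M (at_right 0) at_top"
    by (simp add: filterlim_at)
  have "(\<lambda>x::real. - ln (1 - exp (- x))) \<sim>[at_right 0] (\<lambda>x. - ln x)"
    by real_asymp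
  from asymp_equiv_compose'[OF this M0] have "(\<lambda>k. - ln (1 - exp (- M k))) \<sim>[at_top] (\<lambda>k. - ln (M k))" .
  then show ?thesis using ln_M unfolding M_def by (rule asymp_equiv_trans)
qed

section \<open>Sums along a lattice\<close>

text \<open>
  A form of the Stolz--Cesaro theorem: the relative error of the terms is eventually below \<open>e / 2\<close>, and
  the errors of the remaining finitely many terms are swamped by the diverging sum.
\<close>

lemma asymp_equiv_sum:
  fixes x y :: "nat \<Rightarrow> real"
  assumes xy: "x \<sim>[at_top] y" and pos: "\<forall>\<^sub>F k in at_top. y k > 0"
    and div: "filterlim (\<lambda>n. \<Sum>k<n. y k) at_top at_top"
  shows "(\<lambda>n. \<Sum>k<n. x k) \<sim>[at_top] (\<lambda>n. \<Sum>k<n. y k)"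
proof (rule smallo_imp_asymp_equiv, rule landau_o.smallI)
  fix e :: real assume e: "e > 0"
  have "\<forall>\<^sub>F k in at_top. norm (x k - y k) \<le> e / 2 * norm (y k)"
    using landau_o.smallD[OF asymp_equiv_imp_diff_smallo[OF xy], of "e / 2"] e by simp
  with pos have "\<forall>\<^sub>F k in at_top. y k > 0 \<and> \<bar>x k - y k\<bar> \<le> e / 2 * y k"
    by eventually_elim simp
  then obtain K where K: "\<And>k. k \<ge> K \<Longrightarrow> y k > 0 \<and> \<bar>x k - y k\<bar> \<le> e / 2 * y k"
    by (auto simp: eventually_at_top_linorder)
  define C where "C = (\<Sum>k<K. \<bar>x k - y k\<bar>) - e / 2 * (\<Sum>k<K. y k)"
  have bound: "\<bar>(\<Sum>k<n. x k) - (\<Sum>k<n. y k)\<bar> \<le> C + e / 2 * (\<Sum>k<n. y k)" if "n \<ge> K" for n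
  proof -
    have split: "(\<Sum>k<n. f k) = (\<Sum>k<K. f k) + (\<Sum>k=K..<n. f k)" for f :: "nat \<Rightarrow> real"
      using sum.atLeastLessThan_concat[of 0 K n f] that by (simp add: lessThan_atLeast0)
    have "\<bar>(\<Sum>k<n. x k) - (\<Sum>k<n. y k)\<bar> \<le> (\<Sum>k<n. \<bar>x k - y k\<bar>)"
      unfolding sum_subtractf[symmetric] by (rule sum_abs)
    also have "\<dots> \<le> (\<Sum>k<K. \<bar>x k - y k\<bar>) + (\<Sum>k=K..<n. e / 2 * y k)"
      unfolding split by (intro add_left_mono sum_mono) (use K in auto)
    also have "\<dots> = C + e / 2 * (\<Sum>k<n. y k)"
      unfolding C_def split[of y] sum_distrib_left[symmetric] by (simp add: algebra_simps)
    finally show ?thesis .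
  qed
  have "\<forall>\<^sub>F n in at_top. (\<Sum>k<n. y k) \<ge> max 0 (2 * C / e)"
    using div unfolding filterlim_at_top by blast
  then show "\<forall>\<^sub>F n in at_top. norm ((\<Sum>k<n. x k) - (\<Sum>k<n. y k)) \<le> e * norm (\<Sum>k<n. y k)"
    using eventually_ge_at_top[of K]
  proof eventually_elim
    case (elim n)
    then have "C \<le> e / 2 * (\<Sum>k<n. y k)" using e by (simp add: field_simps)
    then show ?case using bound[of n] elim by simp
  qed
qed

text \<open>
  The sum is compared with the telescoping sum of \<open>(\<Phi> ((k + 1) c) - \<Phi> (k c)) / c\<close>, whose terms are
  asymptotic to \<open>h (k c)\<close>.
\<close>

lemma sum_lattice_asymp:
  fixes h \<Phi> :: "real \<Rightarrow> real"
  assumes x: "x \<sim>[at_top] (\<lambda>k::nat. h (real k * c))" and c: "0 < c"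
    and h: "filterlim h at_top at_top" and \<Phi>: "filterlim \<Phi> at_top at_top"
    and diff: "(\<lambda>t. \<Phi> (t + c) - \<Phi> t) \<sim>[at_top] (\<lambda>t. c * h t)"
  shows "(\<lambda>n. \<Sum>k<n. x k) \<sim>[at_top] (\<lambda>n. \<Phi> (real n * c) / c)"
proof -
  define y where "y k = (\<Phi> (real (Suc k) * c) - \<Phi> (real k * c)) / c" for k
  have kc: "filterlim (\<lambda>k::nat. real k * c) at_top at_top"
    using c by real_asymp
  have "(\<lambda>k. \<Phi> (real k * c + c) - \<Phi> (real k * c)) \<sim>[at_top] (\<lambda>k. c * h (real k * c))"
    by (rule asymp_equiv_compose'[OF diff kc])
  from asymp_equiv_divide[OF this asymp_equiv_refl[of "\<lambda>_. c"]]
  have y: "y \<sim>[at_top] (\<lambda>k. h (real k * c))"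
    using c unfolding y_def by (simp add: algebra_simps)
  have sum_y: "(\<Sum>k<n. y k) = \<Phi> (real n * c) / c + - \<Phi> 0 / c" for n
    unfolding y_def sum_divide_distrib[symmetric] sum_lessThan_telescope[of "\<lambda>k. \<Phi> (real k * c)"]
    by (simp add: diff_divide_distrib)
  have \<Phi>c: "filterlim (\<lambda>n. \<Phi> (real n * c) / c) at_top at_top"
    using filterlim_at_top_mult_tendsto_pos[OF tendsto_const[of "1 / c"] _ filterlim_compose[OF \<Phi> kc]] c
    by simp
  have "\<forall>\<^sub>F k in at_top. h (real k * c) > 0"
    using filterlim_compose[OF h kc] unfolding filterlim_at_top_dense by blast
  with asymp_equiv_eventually_pos_iff[OF y] have pos: "\<forall>\<^sub>F k in at_top. y k > 0"
    by eventually_elim simp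
  have sum_y': "(\<lambda>n. \<Sum>k<n. y k) \<sim>[at_top] (\<lambda>n. \<Phi> (real n * c) / c)"
  proof -
    have "(\<lambda>_. - \<Phi> 0 / c) \<in> o[at_top](\<lambda>n. \<Phi> (real n * c) / c)"
      using \<Phi>c by (intro smalloI_tendsto tendsto_divide_0[OF tendsto_const]
          filterlim_at_top_imp_at_infinity filterlim_at_top_dense[THEN iffD1, rule_format, THEN eventually_mono])
        auto
    from asymp_equiv_add_right[OF this, of "\<lambda>n. \<Phi> (real n * c) / c"] show ?thesis
      unfolding sum_y by simp
  qed
  have "(\<lambda>n. \<Sum>k<n. x k) \<sim>[at_top] (\<lambda>n. \<Sum>k<n. y k)"
    by (rule asymp_equiv_sum[OF asymp_equiv_trans[OF x asymp_equiv_symI[OF y]] pos])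
      (rule asymp_equiv_at_top_transfer[OF asymp_equiv_symI[OF sum_y'] \<Phi>c])
  then show ?thesis using sum_y' by (rule asymp_equiv_trans)
qed

text \<open>
  The number of windows used up to time \<open>t\<close> is \<open>n t\<close>. Rounding \<open>t / c\<close> to an integer moves the argument of \<open>\<Phi>\<close> by a bounded amount,
  to which \<open>\<Phi>\<close> is insensitive.
\<close>

lemma sum_lattice_asymp_continuous:
  fixes h \<Phi> :: "real \<Rightarrow> real" and n :: "real \<Rightarrow> nat"
  assumes x: "x \<sim>[at_top] (\<lambda>k::nat. h (real k * c))" and c: "0 < c"
    and h: "filterlim h at_top at_top" and \<Phi>: "filterlim \<Phi> at_top at_top"
    and diff: "(\<lambda>t. \<Phi> (t + c) - \<Phi> t) \<sim>[at_top] (\<lambda>t. c * h t)"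
    and mono: "mono_on {T..} \<Phi>" and shift: "(\<lambda>t. \<Phi> (t + 2 * c)) \<sim>[at_top] \<Phi>"
    and n: "\<And>t. t > 0 \<Longrightarrow> t \<le> real (n t) * c \<and> real (n t) * c \<le> t + 2 * c"
  shows "(\<lambda>t. \<Sum>k<n t. x k) \<sim>[at_top] (\<lambda>t. \<Phi> t / c)"
proof -
  have lim: "filterlim n at_top at_top"
    unfolding filterlim_at_top
  proof
    fix Z :: nat
    show "\<forall>\<^sub>F t in at_top. Z \<le> n t"
      using eventually_gt_at_top[of "max 0 (real Z * c)"]
    proof eventually_elim
      case (elim t)
      then have "real Z * c \<le> real (n t) * c" using n[of t] by simp
      then show ?case using c by simp
    qed
  qed
  have "(\<lambda>t. \<Phi> (real (n t) * c)) \<sim>[at_top] \<Phi>"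
  proof (rule asymp_equiv_sandwich_real[OF asymp_equiv_refl shift])
    show "\<forall>\<^sub>F t in at_top. \<Phi> (real (n t) * c) \<in> {\<Phi> t..\<Phi> (t + 2 * c)}"
      using eventually_gt_at_top[of "max 0 T"]
    proof eventually_elim
      case (elim t)
      then show ?case using n[of t] by (auto intro!: mono_onD[OF mono])
    qed
  qed
  from asymp_equiv_divide[OF this asymp_equiv_refl[of "\<lambda>_. c"]]
  have "(\<lambda>t. \<Phi> (real (n t) * c) / c) \<sim>[at_top] (\<lambda>t. \<Phi> t / c)" .
  with asymp_equiv_compose'[OF sum_lattice_asymp[OF x c h \<Phi> diff] lim]
  show ?thesis by (rule asymp_equiv_trans)
qed

section \<open>Tail asymptotics of the first gap\<close>

text \<open>
  The lattice of mesh \<open>l\<close> shows that \<open>- ln P(D > t)\<close> is at least asymptotically \<open>\<Phi> t / l\<close>, and a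
  lattice of mesh \<open>c < l\<close> that it is at most asymptotically \<open>\<Phi> t / c\<close>. The hypotheses ask that \<open>h\<close> and \<open>\<Phi>\<close> do not notice bounded shifts, and that \<open>\<Phi>\<close>
  grows like an antiderivative of \<open>h\<close>; the condition on increments allows a simple
  closed form for \<open>\<Phi>\<close> where the antiderivative itself has no elementary one, as for \<open>ln (ln t)\<close>.
\<close>

lemma first_gap_tail_log_equiv:
  fixes h \<Phi> :: "real \<Rightarrow> real"
  assumes l: "0 < l"
    and meas: "\<mu> \<in> borel_measurable (restrict_space borel {0<..})"
    and fin: "\<And>t. emeasure (intensity \<mu>) {0<..t} < \<infinity>"
    and pos: "AE t in lborel. t \<ge> 0 \<longrightarrow> \<mu> t > 0"
    and ppp: "poisson_point_process P (intensity \<mu>) N"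
    and \<mu>: "\<forall>\<^sub>F t in at_top. \<mu> t = exp (- h t)"
    and h: "mono_on {T..} h" "filterlim h at_top at_top"
      "\<And>d. d > 0 \<Longrightarrow> (\<lambda>t. h (t + d)) \<sim>[at_top] h"
    and \<Phi>: "mono_on {T..} \<Phi>" "filterlim \<Phi> at_top at_top"
      "\<And>d. d > 0 \<Longrightarrow> (\<lambda>t. \<Phi> (t + d)) \<sim>[at_top] \<Phi>"
    and diff: "\<And>c. c > 0 \<Longrightarrow> (\<lambda>t. \<Phi> (t + c) - \<Phi> t) \<sim>[at_top] (\<lambda>t. c * h t)"
  shows "(\<lambda>t. measure P {\<omega> \<in> space P. first_gap l (N \<omega>) > ereal t}) \<approx>\<^bsub>log\<^esub> (\<lambda>t. exp (- (\<Phi> t / l)))"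
proof -
  interpret poisson_point_process P "intensity \<mu>" N by (rule ppp)
  define D where "D t = measure P {\<omega> \<in> space P. first_gap l (N \<omega>) > ereal t}" for t
  define p where "p c \<delta> k = 1 - exp (- measure (intensity \<mu>) {real k * c<..real k * c + \<delta>})" for c \<delta> :: real and k :: nat
  have p_pos: "p c \<delta> k > 0" if "c > 0" "\<delta> > 0" for c \<delta> k
    unfolding p_def using window_mass_pos[OF meas fin pos, of "real k * c" "real k * c + \<delta>"] that by simp
  have \<Phi>_pos: "\<forall>\<^sub>F t in at_top. \<Phi> t > 0"
    using \<Phi>(2) unfolding filterlim_at_top_dense by blast
  have sums: "((\<lambda>t. (\<Sum>k<n t. - ln (p c \<delta> k)) / (\<Phi> t / l)) \<longlongrightarrow> l / c) at_top"
    if c: "c > 0" "\<delta> > 0" and n: "\<And>t. t > 0 \<Longrightarrow> t \<le> real (n t) * c \<and> real (n t) * c \<le> t + 2 * c"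
    for c \<delta> :: real and n :: "real \<Rightarrow> nat"
  proof -
    have "(\<lambda>k. - ln (p c \<delta> k)) \<sim>[at_top] (\<lambda>k. h (real k * c))"
      unfolding p_def by (rule neg_ln_hit_prob_asymp[OF meas \<mu> h c])
    from sum_lattice_asymp_continuous[OF this c(1) h(2) \<Phi>(2) diff[OF c(1)] \<Phi>(1) \<Phi>(3) n] c
    have "(\<lambda>t. \<Sum>k<n t. - ln (p c \<delta> k)) \<sim>[at_top] (\<lambda>t. \<Phi> t / c)" by simp
    moreover have "\<forall>\<^sub>F t in at_top. (\<Sum>k<n t. - ln (p c \<delta> k)) \<noteq> 0 \<or> \<Phi> t / c \<noteq> 0"
      using \<Phi>_pos by eventually_elim (use c in simp)
    ultimately have "((\<lambda>t. (\<Sum>k<n t. - ln (p c \<delta> k)) / (\<Phi> t / c)) \<longlongrightarrow> 1) at_top"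
      by (rule asymp_equivD_strong)
    from tendsto_mult[OF this tendsto_const[of "l / c"]] c show ?thesis by simp
  qed
  define m where "m c t = nat \<lfloor>t / c\<rfloor>" for c t :: real
  have m: "real (m c t) * c \<le> t" "t < (real (m c t) + 1) * c" if "c > 0" "t > 0" for c t
  proof -
    have "0 \<le> t / c" using that by simp
    then have "real (m c t) \<le> t / c" "t / c < real (m c t) + 1"
      unfolding m_def using floor_correct[of "t / c"] by simp_all
    then show "real (m c t) * c \<le> t" "t < (real (m c t) + 1) * c"
      using that by (simp_all add: pos_le_divide_eq pos_divide_less_eq)
  qed
  have ge: "(\<Prod>k<m c t + 2. p c \<delta> k) \<le> D t"
    if c: "0 < c" "0 < \<delta>" "\<delta> \<le> c" "c + \<delta> < l" and t: "0 < t" for c \<delta> t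
    unfolding p_def D_def
    by (rule prob_first_gap_gt_ge[OF l t fin c]) (use m[OF c(1) t] in \<open>simp add: algebra_simps\<close>)
  have ge_ln: "0 < D t" "- ln (D t) \<le> (\<Sum>k<m c t + 2. - ln (p c \<delta> k))"
    if c: "0 < c" "0 < \<delta>" "\<delta> \<le> c" "c + \<delta> < l" and t: "0 < t" for c \<delta> t
  proof -
    have prod: "0 < (\<Prod>k<m c t + 2. p c \<delta> k)" using p_pos c by (intro prod_pos) auto
    with ge[OF that] show "0 < D t" by linarith
    have "ln (\<Prod>k<m c t + 2. p c \<delta> k) \<le> ln (D t)" using ge[OF that] prod by (intro ln_mono) auto
    moreover have "ln (\<Prod>k<m c t + 2. p c \<delta> k) = (\<Sum>k<m c t + 2. ln (p c \<delta> k))"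
      using p_pos[OF c(1,2)] by (intro ln_prod) (auto simp: less_imp_neq[symmetric])
    ultimately show "- ln (D t) \<le> (\<Sum>k<m c t + 2. - ln (p c \<delta> k))" by (simp add: sum_negf)
  qed
  have D_pos: "0 < D t" if "0 < t" for t
    \<comment> \<open>Any admissible pair \<open>c\<close>, \<open>\<delta>\<close> will do here.\<close>
    using ge_ln(1)[of "l / 2" "l / 4" t] l that by simp
  have le_ln: "(\<Sum>k<m l t + 1. - ln (p l l k)) \<le> - ln (D t)" if t: "0 < t" for t
  proof -
    have "real k * l \<le> t" if "k < m l t + 1" for k
    proof -
      have "real k * l \<le> real (m l t) * l" using that l by (intro mult_right_mono) auto
      then show ?thesis using m[OF l t] by linarith
    qed
    then have "D t \<le> (\<Prod>k<m l t + 1. p l l k)"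
      unfolding p_def D_def by (intro prob_first_gap_gt_le[OF l t fin]) auto
    then have "ln (D t) \<le> ln (\<Prod>k<m l t + 1. p l l k)" using D_pos[OF t] by (intro ln_mono) auto
    moreover have "ln (\<Prod>k<m l t + 1. p l l k) = (\<Sum>k<m l t + 1. ln (p l l k))"
      using p_pos[OF l l] by (intro ln_prod) (auto simp: less_imp_neq[symmetric])
    ultimately show ?thesis by (simp add: sum_negf)
  qed
  have "((\<lambda>t. - ln (D t) / (\<Phi> t / l)) \<longlongrightarrow> 1) at_top"
  proof (rule order_tendstoI)
    fix a :: real assume a: "a < 1"
    have "((\<lambda>t. (\<Sum>k<m l t + 1. - ln (p l l k)) / (\<Phi> t / l)) \<longlongrightarrow> l / l) at_top"
      by (rule sums[OF l l]) (use m[OF l] l in \<open>force simp: algebra_simps\<close>)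
    then have "\<forall>\<^sub>F t in at_top. a < (\<Sum>k<m l t + 1. - ln (p l l k)) / (\<Phi> t / l)"
      by (rule order_tendstoD) (use a l in simp)
    then show "\<forall>\<^sub>F t in at_top. a < - ln (D t) / (\<Phi> t / l)"
      using \<Phi>_pos eventually_gt_at_top[of 0]
    proof eventually_elim
      case (elim t)
      have "(\<Sum>k<m l t + 1. - ln (p l l k)) / (\<Phi> t / l) \<le> - ln (D t) / (\<Phi> t / l)"
        using elim l by (intro divide_right_mono le_ln) auto
      with elim show ?case by linarith
    qed
  next
    fix a :: real assume a: "a > 1"
    \<comment> \<open>With \<open>l / a < c < l\<close> the limit \<open>l / c\<close> of the upper estimate is below \<open>a\<close>.\<close>
    then have "l / a < l" using l by (simp add: divide_less_eq)
    then obtain c where c: "l / a < c" "c < l" using dense by blast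
    have "0 < l / a" using l a by simp
    with c have c0: "0 < c" by linarith
    define \<delta> where "\<delta> = min c ((l - c) / 2)"
    have \<delta>: "0 < \<delta>" "\<delta> \<le> c" "c + \<delta> < l" unfolding \<delta>_def using c c0 by (auto simp: min_def field_simps)
    have "((\<lambda>t. (\<Sum>k<m c t + 2. - ln (p c \<delta> k)) / (\<Phi> t / l)) \<longlongrightarrow> l / c) at_top"
      by (rule sums[OF c0 \<delta>(1)]) (use m[OF c0] c0 in \<open>force simp: algebra_simps\<close>)
    then have "\<forall>\<^sub>F t in at_top. (\<Sum>k<m c t + 2. - ln (p c \<delta> k)) / (\<Phi> t / l) < a"
      by (rule order_tendstoD) (use a c c0 in \<open>simp add: field_simps\<close>)
    then show "\<forall>\<^sub>F t in at_top. - ln (D t) / (\<Phi> t / l) < a"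
      using \<Phi>_pos eventually_gt_at_top[of 0]
    proof eventually_elim
      case (elim t)
      have "- ln (D t) / (\<Phi> t / l) \<le> (\<Sum>k<m c t + 2. - ln (p c \<delta> k)) / (\<Phi> t / l)"
        using elim l by (intro divide_right_mono ge_ln(2)[OF c0 \<delta>]) auto
      with elim show ?case by linarith
    qed
  qed
  then show ?thesis unfolding log_equiv_def D_def[symmetric] by simp
qed

theorem corollary5p2:
  fixes P :: "'w measure" and N :: "'w \<Rightarrow> real set" and \<mu> :: "real \<Rightarrow> real"
    and l a b :: real
  assumes "l > 0"
    and "\<mu> \<in> borel_measurable (restrict_space borel {0<..})"
    and "\<And>t. t > 0 \<Longrightarrow> \<mu> t \<ge> 0"
    and "\<And>t. t > 0 \<Longrightarrow> emeasure (intensity \<mu>) {0<..t} < \<infinity>"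
    and "AE t in lborel. t \<ge> 0 \<longrightarrow> \<mu> t > 0"
    and "poisson_point_process P (intensity \<mu>) N"
    and "a > 0" and "b > 0"
  shows
    "((\<forall>\<^sub>F t in at_top. \<mu> t = a * (ln t) powr (- b)) \<longrightarrow>
        (\<lambda>t. measure P {\<omega> \<in> space P. first_gap l (N \<omega>) > ereal t})
          \<approx>\<^bsub>log\<^esub> (\<lambda>t. exp (- (b * t * ln (ln t) / l)))) \<and>
     ((\<forall>\<^sub>F t in at_top. \<mu> t = a * t powr (- b)) \<longrightarrow>
        (\<lambda>t. measure P {\<omega> \<in> space P. first_gap l (N \<omega>) > ereal t})
          \<approx>\<^bsub>log\<^esub> (\<lambda>t. exp (- (b * t * ln t / l)))) \<and>
     ((\<forall>\<^sub>F t in at_top. \<mu> t = a * exp (- (b * t))) \<longrightarrow>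
        (\<lambda>t. measure P {\<omega> \<in> space P. first_gap l (N \<omega>) > ereal t})
          \<approx>\<^bsub>log\<^esub> (\<lambda>t. exp (- (b * t\<^sup>2 / (2 * l)))))"
proof -
  have fin: "emeasure (intensity \<mu>) {0<..t} < \<infinity>" for t
    using assms(4)[of t] by (cases "t > 0") auto
  note tail = first_gap_tail_log_equiv[OF assms(1,2) fin assms(5,6)]
  have pos: "0 < a" "0 < b" by fact+
  have "(\<lambda>t. measure P {\<omega> \<in> space P. first_gap l (N \<omega>) > ereal t})
          \<approx>\<^bsub>log\<^esub> (\<lambda>t. exp (- (b * t * ln (ln t) / l)))"
    if \<mu>: "\<forall>\<^sub>F t in at_top. \<mu> t = a * (ln t) powr (- b)"
  proof (rule tail)
    show "\<forall>\<^sub>F t in at_top. \<mu> t = exp (- (- ln a + b * ln (ln t)))"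
      using \<mu> eventually_gt_at_top[of 1]
      by eventually_elim (use pos in \<open>simp add: powr_def exp_add exp_diff exp_minus divide_inverse\<close>)
    \<comment> \<open>Monotonicity of \<open>t * ln (ln t)\<close> needs \<open>ln (ln t) \<ge> 0\<close>, hence the range \<open>t \<ge> exp 1\<close>.\<close>
    have ln_ge1: "1 \<le> ln t" "0 < t" if "t \<in> {exp 1..}" for t :: real
    proof -
      show "0 < t" using that by (auto intro: less_le_trans[OF exp_gt_zero])
      then show "1 \<le> ln t" using that by (simp add: ln_ge_iff)
    qed
    have ln_ln_mono: "ln (ln s) \<le> ln (ln t)" if "s \<in> {exp 1..}" "s \<le> t" for s t :: real
    proof -
      have "ln s \<le> ln t" using ln_ge1[OF that(1)] that(2) by (intro ln_mono) auto
      then show ?thesis by (rule ln_mono) (use ln_ge1(1)[OF that(1)] in linarith)+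
    qed
    show "mono_on {exp 1..} (\<lambda>t. - ln a + b * ln (ln t))"
      using pos ln_ln_mono by (intro mono_onI add_left_mono mult_left_mono) auto
    show "mono_on {exp 1..} (\<lambda>t. b * t * ln (ln t))"
    proof (rule mono_onI)
      fix s t :: real assume st: "s \<in> {exp 1..}" "t \<in> {exp 1..}" "s \<le> t"
      show "b * s * ln (ln s) \<le> b * t * ln (ln t)"
        using pos st ln_ge1[OF st(1)] ln_ge1[OF st(2)] ln_ln_mono[OF st(1,3)]
        by (intro mult_mono mult_left_mono) auto
    qed
  qed (use pos in \<open>real_asymp+\<close>)
  moreover have "(\<lambda>t. measure P {\<omega> \<in> space P. first_gap l (N \<omega>) > ereal t})
          \<approx>\<^bsub>log\<^esub> (\<lambda>t. exp (- (b * t * ln t / l)))"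
    if \<mu>: "\<forall>\<^sub>F t in at_top. \<mu> t = a * t powr (- b)"
  proof (rule tail)
    show "\<forall>\<^sub>F t in at_top. \<mu> t = exp (- (- ln a + b * ln t))"
      using \<mu> eventually_gt_at_top[of 0]
      by eventually_elim (use pos in \<open>simp add: powr_def exp_add exp_diff exp_minus divide_inverse\<close>)
    show "mono_on {1..} (\<lambda>t. - ln a + b * ln t)"
      using pos by (auto intro!: mono_onI ln_mono mult_left_mono)
    show "mono_on {1..} (\<lambda>t. b * t * ln t)"
      using pos by (auto intro!: mono_onI mult_mono ln_mono)
  qed (use pos in \<open>real_asymp+\<close>)
  moreover have "(\<lambda>t. measure P {\<omega> \<in> space P. first_gap l (N \<omega>) > ereal t})
          \<approx>\<^bsub>log\<^esub> (\<lambda>t. exp (- (b * t\<^sup>2 / (2 * l))))"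
    if \<mu>: "\<forall>\<^sub>F t in at_top. \<mu> t = a * exp (- (b * t))"
  proof -
    have "(\<lambda>t. measure P {\<omega> \<in> space P. first_gap l (N \<omega>) > ereal t})
          \<approx>\<^bsub>log\<^esub> (\<lambda>t. exp (- (b * t\<^sup>2 / 2 / l)))"
    proof (rule tail)
      show "\<forall>\<^sub>F t in at_top. \<mu> t = exp (- (- ln a + b * t))"
        using \<mu>
        by eventually_elim (use pos in \<open>simp add: exp_add exp_diff exp_minus divide_inverse\<close>)
      show "mono_on {0..} (\<lambda>t. - ln a + b * t)"
        using pos by (auto intro!: mono_onI mult_left_mono)
      show "mono_on {0..} (\<lambda>t. b * t\<^sup>2 / 2)"
        using pos by (auto intro!: mono_onI mult_left_mono power_mono)
    qed (use pos in \<open>real_asymp+\<close>)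
    then show ?thesis by simp
  qed
  ultimately show ?thesis by blast
qed

end
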